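(* Let $\alpha_0,\dots,\alpha_4$ be complex parameters with $\alpha_0+\alpha_1+2\alpha_2+\alpha_3+\alpha_4=1$, and consider the autonomous system of ordinary differential equations in the unknowns $f_0,f_1,f_2,f_3,f_4,g_1,g_2$ $$ \begin{aligned} \frac{df_0}{dt} &=-(2f_1g_1+\alpha_1)f_0-\alpha_0f_1,\\ \frac{df_1}{dt} &=-(2f_0g_1+\alpha_0)f_1-\alpha_1f_0,\\ \frac{df_2}{dt} &=\{(f_0+f_1)g_1+(f_3+f_4)g_2+1\}f_2-2\alpha_2 g_1g_2,\\ \frac{df_3}{dt} &=-(2f_4g_2+\alpha_4)f_3-\alpha_3f_4,\\ \frac{df_4}{dt} &=-(2f_3g_2+\alpha_3)f_4-\alpha_4f_3,\\ \frac{dg_1}{dt} &=(f_0+f_1)g_1^2-\{(f_3+f_4)g_2-\alpha_0-\alpha_1\}g_1+(f_3+f_4)f_2,\\ \frac{dg_2}{dt} &=(f_3+f_4)g_2^2-\{(f_0+f_1)g_1-\alpha_3-\alpha_4\}g_2+(f_0+f_1)f_2. \end{aligned} $$ This system is invariant under each of the transformations $s_0,\dots,s_4$ defined as follows, where $( * ):=(f_0,f_1,f_2,f_3,f_4,g_1,g_2;\alpha_0,\alpha_1,\alpha_2,\alpha_3,\alpha_4)$: $$ \begin{aligned} s_0:( * ) \mapsto &\Big(f_0,f_1,f_2+\frac{\alpha_0 g_2}{f_0},f_3,f_4,g_1+\frac{\alpha_0}{f_0},g_2;-\alpha_0,\alpha_1,\alpha_2+\alpha_0,\alpha_3,\alpha_4\Big),\\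 s_1:( * ) \mapsto &\Big(f_0,f_1,f_2+\frac{\alpha_1 g_2}{f_1},f_3,f_4,g_1+\frac{\alpha_1}{f_1},g_2;\alpha_0,-\alpha_1,\alpha_2+\alpha_1,\alpha_3,\alpha_4\Big),\\ s_2:( * ) \mapsto &\Big(f_0-\frac{\alpha_2 g_2}{f_2},f_1-\frac{\alpha_2 g_2}{f_2},f_2,f_3-\frac{\alpha_2 g_1}{f_2},f_4-\frac{\alpha_2 g_1}{f_2},g_1,g_2;\\ &\quad\alpha_0+\alpha_2,\alpha_1+\alpha_2,-\alpha_2,\alpha_3+\alpha_2,\alpha_4+\alpha_2\Big),\\ s_3:( * ) \mapsto &\Big(f_0,f_1,f_2+\frac{\alpha_3 g_1}{f_3},f_3,f_4,g_1,g_2+\frac{\alpha_3}{f_3};\alpha_0,\alpha_1,\alpha_2+\alpha_3,-\alpha_3,\alpha_4\Big),\\ s_4:( * ) \mapsto &\Big(f_0,f_1,f_2+\frac{\alpha_4 g_1}{f_4},f_3,f_4,g_1,g_2+\frac{\alpha_4}{f_4};\alpha_0,\alpha_1,\alpha_2+\alpha_4,\alpha_3,-\alpha_4\Big). \end{aligned} $$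
   Context: All unknowns are complex variables and $t$ is the (complex) independent variable. Invariance of the system under a transformation $s:(f_0,\dots,f_4,g_1,g_2;\alpha_0,\dots,\alpha_4)\mapsto(\tilde f_0,\dots,\tilde f_4,\tilde g_1,\tilde g_2;\tilde\alpha_0,\dots,\tilde\alpha_4)$ means: whenever $(f_0,\dots,f_4,g_1,g_2)$ is a solution of the system with parameters $(\alpha_0,\dots,\alpha_4)$ (on a domain where the denominators occurring in $s$ do not vanish), the functions $(\tilde f_0,\dots,\tilde f_4,\tilde g_1,\tilde g_2)$ form a solution of the same system with the parameters replaced by $(\tilde\alpha_0,\dots,\tilde\alpha_4)$. *)

theory Defs
  imports Complex_Main
begin

text \<open>
  The unknowns are functions of the complex variable \<open>t\<close>, listed in the order
  \<open>(f0, f1, f2, f3, f4, g1, g2)\<close>; the parameters are \<open>(\<alpha>0, \<alpha>1, \<alpha>2, \<alpha>3, \<alpha>4)\<close>.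
\<close>

type_synonym cfun = "complex \<Rightarrow> complex"
type_synonym unknowns = "cfun \<times> cfun \<times> cfun \<times> cfun \<times> cfun \<times> cfun \<times> cfun"
type_synonym params = "complex \<times> complex \<times> complex \<times> complex \<times> complex"

fun normalized :: "params \<Rightarrow> bool" where
  "normalized (\<alpha>0, \<alpha>1, \<alpha>2, \<alpha>3, \<alpha>4) \<longleftrightarrow> \<alpha>0 + \<alpha>1 + 2 * \<alpha>2 + \<alpha>3 + \<alpha>4 = 1"

text \<open>
  Solutions on a set \<open>D\<close>, which is always taken to be open below, so that \<open>at t\<close>
  gives the complex derivative.
\<close>

fun solution_on :: "complex set \<Rightarrow> unknowns \<times> params \<Rightarrow> bool" where
  "solution_on D ((f0, f1, f2, f3, f4, g1, g2), (\<alpha>0, \<alpha>1, \<alpha>2, \<alpha>3, \<alpha>4)) \<longleftrightarrow>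
    (\<forall>t\<in>D.
      (f0 has_field_derivative
         - (2 * f1 t * g1 t + \<alpha>1) * f0 t - \<alpha>0 * f1 t) (at t) \<and>
      (f1 has_field_derivative
         - (2 * f0 t * g1 t + \<alpha>0) * f1 t - \<alpha>1 * f0 t) (at t) \<and>
      (f2 has_field_derivative
         ((f0 t + f1 t) * g1 t + (f3 t + f4 t) * g2 t + 1) * f2 t - 2 * \<alpha>2 * g1 t * g2 t) (at t) \<and>
      (f3 has_field_derivative
         - (2 * f4 t * g2 t + \<alpha>4) * f3 t - \<alpha>3 * f4 t) (at t) \<and>
      (f4 has_field_derivative
         - (2 * f3 t * g2 t + \<alpha>3) * f4 t - \<alpha>4 * f3 t) (at t) \<and>
      (g1 has_field_derivative
         (f0 t + f1 t) * (g1 t)\<^sup>2 - ((f3 t + f4 t) * g2 t - \<alpha>0 - \<alpha>1) * g1 t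
           + (f3 t + f4 t) * f2 t) (at t) \<and>
      (g2 has_field_derivative
         (f3 t + f4 t) * (g2 t)\<^sup>2 - ((f0 t + f1 t) * g1 t - \<alpha>3 - \<alpha>4) * g2 t
           + (f0 t + f1 t) * f2 t) (at t))"

fun s0 :: "unknowns \<times> params \<Rightarrow> unknowns \<times> params" where
  "s0 ((f0, f1, f2, f3, f4, g1, g2), (\<alpha>0, \<alpha>1, \<alpha>2, \<alpha>3, \<alpha>4)) =
    ((f0, f1, \<lambda>t. f2 t + \<alpha>0 * g2 t / f0 t, f3, f4, \<lambda>t. g1 t + \<alpha>0 / f0 t, g2),
     (- \<alpha>0, \<alpha>1, \<alpha>2 + \<alpha>0, \<alpha>3, \<alpha>4))"

fun s1 :: "unknowns \<times> params \<Rightarrow> unknowns \<times> params" where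
  "s1 ((f0, f1, f2, f3, f4, g1, g2), (\<alpha>0, \<alpha>1, \<alpha>2, \<alpha>3, \<alpha>4)) =
    ((f0, f1, \<lambda>t. f2 t + \<alpha>1 * g2 t / f1 t, f3, f4, \<lambda>t. g1 t + \<alpha>1 / f1 t, g2),
     (\<alpha>0, - \<alpha>1, \<alpha>2 + \<alpha>1, \<alpha>3, \<alpha>4))"

fun s2 :: "unknowns \<times> params \<Rightarrow> unknowns \<times> params" where
  "s2 ((f0, f1, f2, f3, f4, g1, g2), (\<alpha>0, \<alpha>1, \<alpha>2, \<alpha>3, \<alpha>4)) =
    ((\<lambda>t. f0 t - \<alpha>2 * g2 t / f2 t, \<lambda>t. f1 t - \<alpha>2 * g2 t / f2 t, f2,
      \<lambda>t. f3 t - \<alpha>2 * g1 t / f2 t, \<lambda>t. f4 t - \<alpha>2 * g1 t / f2 t, g1, g2),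
     (\<alpha>0 + \<alpha>2, \<alpha>1 + \<alpha>2, - \<alpha>2, \<alpha>3 + \<alpha>2, \<alpha>4 + \<alpha>2))"

fun s3 :: "unknowns \<times> params \<Rightarrow> unknowns \<times> params" where
  "s3 ((f0, f1, f2, f3, f4, g1, g2), (\<alpha>0, \<alpha>1, \<alpha>2, \<alpha>3, \<alpha>4)) =
    ((f0, f1, \<lambda>t. f2 t + \<alpha>3 * g1 t / f3 t, f3, f4, g1, \<lambda>t. g2 t + \<alpha>3 / f3 t),
     (\<alpha>0, \<alpha>1, \<alpha>2 + \<alpha>3, - \<alpha>3, \<alpha>4))"

fun s4 :: "unknowns \<times> params \<Rightarrow> unknowns \<times> params" where
  "s4 ((f0, f1, f2, f3, f4, g1, g2), (\<alpha>0, \<alpha>1, \<alpha>2, \<alpha>3, \<alpha>4)) =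
    ((f0, f1, \<lambda>t. f2 t + \<alpha>4 * g1 t / f4 t, f3, f4, g1, \<lambda>t. g2 t + \<alpha>4 / f4 t),
     (\<alpha>0, \<alpha>1, \<alpha>2 + \<alpha>4, \<alpha>3, - \<alpha>4))"

text \<open>
  Invariance, at the parameters \<open>\<alpha>\<close>, of the system under a transformation \<open>s\<close> whose
  only denominator is the unknown selected by \<open>den\<close>. The normalization of the
  parameters is part of the system, so the new parameters must satisfy it as well.
\<close>

definition invariant_under ::
  "(unknowns \<times> params \<Rightarrow> unknowns \<times> params) \<Rightarrow> (unknowns \<Rightarrow> cfun) \<Rightarrow> params \<Rightarrow> bool" where
  "invariant_under s den \<alpha> \<longleftrightarrow>
    (\<forall>D u. open D \<longrightarrow> solution_on D (u, \<alpha>) \<longrightarrow> (\<forall>t\<in>D. den u t \<noteq> 0) \<longrightarrow>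
      normalized (snd (s (u, \<alpha>))) \<and> solution_on D (s (u, \<alpha>)))"

end

theory Submission
  imports Defs
begin

text \<open>
  The system is symmetric under the exchange of \<open>(f0, \<alpha>0)\<close> with \<open>(f1, \<alpha>1)\<close> and under the
  exchange of \<open>(f0, f1, g1; \<alpha>0, \<alpha>1)\<close> with \<open>(f3, f4, g2; \<alpha>3, \<alpha>4)\<close>. These exchanges generate a
  group that permutes the indices \<open>0, 1, 3, 4\<close> transitively and conjugates \<open>s0\<close> into \<open>s1\<close>, \<open>s3\<close>
  and \<open>s4\<close>, so only \<open>s0\<close> and \<open>s2\<close> have to be computed.

  Each of these two shifts some unknowns by multiples of one function \<open>q = \<alpha>i / fi\<close>.
  The equation for \<open>fi\<close> has the form \<open>fi' = - A fi - \<alpha>i B\<close>, so \<open>q\<close> solves the Riccati equation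
  \<open>q' = A q + B q\<^sup>2\<close>, which has no denominator. Once \<open>\<alpha>i\<close> is written as \<open>q fi\<close>, every
  equation of the transformed system becomes a polynomial identity in the unknowns, \<open>q\<close> and
  the remaining parameters. The normalization \<open>\<alpha>0 + \<alpha>1 + 2 \<alpha>2 + \<alpha>3 + \<alpha>4 = 1\<close> enters in the
  equation for \<open>f2\<close> under \<open>s0\<close>, and in those for \<open>f0\<close>, \<open>f1\<close>, \<open>f3\<close>, \<open>f4\<close> under \<open>s2\<close>: there the
  constant \<open>1\<close> in the equation for \<open>f2\<close> has to cancel against the parameters.
\<close>

text \<open>
  The term \<open>a * B\<close> is what makes this work: in the equation for \<open>fi\<close> every term without a factor
  \<open>fi\<close> carries the factor \<open>\<alpha>i\<close>, so differentiating \<open>\<alpha>i / fi\<close> produces \<open>\<alpha>i\<^sup>2 / fi\<^sup>2\<close>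
  and no other second-order pole in \<open>fi\<close>.
\<close>

lemma quotient_riccati:
  fixes f :: cfun
  assumes "(f has_field_derivative f') (at t)" and "f' = - A * f t - a * B" and "f t \<noteq> 0"
  shows "((\<lambda>t. a / f t) has_field_derivative A * (a / f t) + B * (a / f t)\<^sup>2) (at t)"
  using assms by (auto intro!: derivative_eq_intros simp: field_simps power2_eq_square)

lemma solution_onD:
  assumes "solution_on D ((f0, f1, f2, f3, f4, g1, g2), (\<alpha>0, \<alpha>1, \<alpha>2, \<alpha>3, \<alpha>4))" and "t \<in> D"
  shows "(f0 has_field_derivative - (2 * f1 t * g1 t + \<alpha>1) * f0 t - \<alpha>0 * f1 t) (at t)"
    and "(f1 has_field_derivative - (2 * f0 t * g1 t + \<alpha>0) * f1 t - \<alpha>1 * f0 t) (at t)"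
    and "(f2 has_field_derivative
       ((f0 t + f1 t) * g1 t + (f3 t + f4 t) * g2 t + 1) * f2 t - 2 * \<alpha>2 * g1 t * g2 t) (at t)"
    and "(f3 has_field_derivative - (2 * f4 t * g2 t + \<alpha>4) * f3 t - \<alpha>3 * f4 t) (at t)"
    and "(f4 has_field_derivative - (2 * f3 t * g2 t + \<alpha>3) * f4 t - \<alpha>4 * f3 t) (at t)"
    and "(g1 has_field_derivative
       (f0 t + f1 t) * (g1 t)\<^sup>2 - ((f3 t + f4 t) * g2 t - \<alpha>0 - \<alpha>1) * g1 t
         + (f3 t + f4 t) * f2 t) (at t)"
    and "(g2 has_field_derivative
       (f3 t + f4 t) * (g2 t)\<^sup>2 - ((f0 t + f1 t) * g1 t - \<alpha>3 - \<alpha>4) * g2 t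
         + (f0 t + f1 t) * f2 t) (at t)"
  using assms by auto

lemma solution_on_swap_01:
  assumes "solution_on D ((f0, f1, f2, f3, f4, g1, g2), (\<alpha>0, \<alpha>1, \<alpha>2, \<alpha>3, \<alpha>4))"
  shows "solution_on D ((f1, f0, f2, f3, f4, g1, g2), (\<alpha>1, \<alpha>0, \<alpha>2, \<alpha>3, \<alpha>4))"
  using assms by (simp add: algebra_simps)

lemma solution_on_swap_01_34:
  assumes "solution_on D ((f0, f1, f2, f3, f4, g1, g2), (\<alpha>0, \<alpha>1, \<alpha>2, \<alpha>3, \<alpha>4))"
  shows "solution_on D ((f3, f4, f2, f0, f1, g2, g1), (\<alpha>3, \<alpha>4, \<alpha>2, \<alpha>0, \<alpha>1))"
  using assms by (simp add: algebra_simps)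

text \<open>
  The shift of \<open>g1\<close> by \<open>q\<close> adds \<open>2 f1 f0 q = 2 \<alpha>0 f1\<close> to the terms \<open>2 f1 g1 f0\<close> and
  \<open>2 f0 g1 f1\<close> of the first two equations, which is undone by \<open>\<alpha>0 \<mapsto> - \<alpha>0\<close>; the shift of
  \<open>f2\<close> by \<open>q g2\<close> is the one that keeps \<open>f2 - g1 g2\<close> fixed, and hence the equation for \<open>g2\<close>,
  in which \<open>f0 + f1\<close> multiplies exactly this combination. In the equation for \<open>f2\<close> the
  parameters are left in the form \<open>q g2 (1 - \<alpha>0 - \<alpha>1 - 2 \<alpha>2 - \<alpha>3 - \<alpha>4)\<close>.
\<close>

lemma solution_on_s0:
  assumes sol: "solution_on D ((f0, f1, f2, f3, f4, g1, g2), (\<alpha>0, \<alpha>1, \<alpha>2, \<alpha>3, \<alpha>4))"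
    and norm: "normalized (\<alpha>0, \<alpha>1, \<alpha>2, \<alpha>3, \<alpha>4)"
    and nz: "\<forall>t\<in>D. f0 t \<noteq> 0"
  shows "solution_on D (s0 ((f0, f1, f2, f3, f4, g1, g2), (\<alpha>0, \<alpha>1, \<alpha>2, \<alpha>3, \<alpha>4)))"
proof -
  define q where "q = (\<lambda>t. \<alpha>0 / f0 t)"
  have "solution_on D ((f0, f1, \<lambda>t. f2 t + q t * g2 t, f3, f4, \<lambda>t. g1 t + q t, g2),
      (- \<alpha>0, \<alpha>1, \<alpha>2 + \<alpha>0, \<alpha>3, \<alpha>4))"
    unfolding solution_on.simps
  proof (rule ballI, goal_cases)
    case t: (1 t)
    note d = solution_onD[OF sol t]
    have dq: "(q has_field_derivative (2 * f1 t * g1 t + \<alpha>1) * q t + f1 t * (q t)\<^sup>2) (at t)"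
      unfolding q_def by (rule quotient_riccati[OF d(1)])
        (use nz t in \<open>simp_all add: algebra_simps\<close>)
    have \<alpha>0: "\<alpha>0 = q t * f0 t"
      using nz t by (simp add: q_def)
    have one: "\<alpha>0 + \<alpha>1 + 2 * \<alpha>2 + \<alpha>3 + \<alpha>4 = 1"
      using norm by simp
    show ?case
      \<comment> \<open>The cases are the equations for \<open>f0, f1, f2, f3, f4, g1, g2\<close>, in this order.\<close>
    proof (intro conjI, goal_cases)
      case 1
      show ?case
        by (rule DERIV_cong[OF d(1)]) (use \<alpha>0 in algebra)
    next
      case 2
      show ?case
        by (rule DERIV_cong[OF d(2)]) (use \<alpha>0 in algebra)
    next
      case 3
      show ?case
        by (rule DERIV_cong[OF DERIV_add[OF d(3) DERIV_mult[OF dq d(7)]]]) (use \<alpha>0 one in algebra)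
    next
      case 4
      show ?case
        by (rule d(4))
    next
      case 5
      show ?case
        by (rule d(5))
    next
      case 6
      show ?case
        by (rule DERIV_cong[OF DERIV_add[OF d(6) dq]]) (use \<alpha>0 in algebra)
    next
      case 7
      show ?case
        by (rule DERIV_cong[OF d(7)]) (simp add: algebra_simps)
    qed
  qed
  then show ?thesis
    by (simp add: q_def)
qed

text \<open>
  In the equations for \<open>f2\<close>, \<open>g1\<close>, \<open>g2\<close> the unknowns \<open>f0, f1, f3, f4\<close> occur only in the sums
  \<open>f0 + f1\<close> and \<open>f3 + f4\<close>, which move by \<open>- 2 q g2\<close> and \<open>- 2 q g1\<close>; with \<open>q f2 = \<alpha>2\<close> this
  amounts to the change of parameters. In the other four equations the shift has to satisfy its
  own differential equation, whose linear coefficient contains the constant \<open>1\<close> from the equation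
  for \<open>f2\<close>; it matches the new parameters by the normalization.
\<close>

lemma solution_on_s2:
  assumes sol: "solution_on D ((f0, f1, f2, f3, f4, g1, g2), (\<alpha>0, \<alpha>1, \<alpha>2, \<alpha>3, \<alpha>4))"
    and norm: "normalized (\<alpha>0, \<alpha>1, \<alpha>2, \<alpha>3, \<alpha>4)"
    and nz: "\<forall>t\<in>D. f2 t \<noteq> 0"
  shows "solution_on D (s2 ((f0, f1, f2, f3, f4, g1, g2), (\<alpha>0, \<alpha>1, \<alpha>2, \<alpha>3, \<alpha>4)))"
proof -
  define q where "q = (\<lambda>t. \<alpha>2 / f2 t)"
  have "solution_on D ((\<lambda>t. f0 t - q t * g2 t, \<lambda>t. f1 t - q t * g2 t, f2,
      \<lambda>t. f3 t - q t * g1 t, \<lambda>t. f4 t - q t * g1 t, g1, g2),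
      (\<alpha>0 + \<alpha>2, \<alpha>1 + \<alpha>2, - \<alpha>2, \<alpha>3 + \<alpha>2, \<alpha>4 + \<alpha>2))"
    unfolding solution_on.simps
  proof (rule ballI, goal_cases)
    case t: (1 t)
    note d = solution_onD[OF sol t]
    have dq: "(q has_field_derivative - ((f0 t + f1 t) * g1 t + (f3 t + f4 t) * g2 t + 1) * q t
        + 2 * g1 t * g2 t * (q t)\<^sup>2) (at t)"
      unfolding q_def by (rule quotient_riccati[OF d(3)])
        (use nz t in \<open>simp_all add: algebra_simps\<close>)
    have \<alpha>2: "\<alpha>2 = q t * f2 t"
      using nz t by (simp add: q_def)
    have one: "\<alpha>0 + \<alpha>1 + 2 * \<alpha>2 + \<alpha>3 + \<alpha>4 = 1"
      using norm by simp
    show ?case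
      \<comment> \<open>The cases are the equations for \<open>f0, f1, f2, f3, f4, g1, g2\<close>, in this order.\<close>
    proof (intro conjI, goal_cases)
      case 1
      show ?case
        by (rule DERIV_cong[OF DERIV_diff[OF d(1) DERIV_mult[OF dq d(7)]]]) (use \<alpha>2 one in algebra)
    next
      case 2
      show ?case
        by (rule DERIV_cong[OF DERIV_diff[OF d(2) DERIV_mult[OF dq d(7)]]]) (use \<alpha>2 one in algebra)
    next
      case 3
      show ?case
        by (rule DERIV_cong[OF d(3)]) (use \<alpha>2 in algebra)
    next
      case 4
      show ?case
        by (rule DERIV_cong[OF DERIV_diff[OF d(4) DERIV_mult[OF dq d(6)]]]) (use \<alpha>2 one in algebra)
    next
      case 5
      show ?case
        by (rule DERIV_cong[OF DERIV_diff[OF d(5) DERIV_mult[OF dq d(6)]]]) (use \<alpha>2 one in algebra)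
    next
      case 6
      show ?case
        by (rule DERIV_cong[OF d(6)]) (use \<alpha>2 in algebra)
    next
      case 7
      show ?case
        by (rule DERIV_cong[OF d(7)]) (use \<alpha>2 in algebra)
    qed
  qed
  then show ?thesis
    by (simp add: q_def)
qed

text \<open>
  The remaining three reflections are conjugates: \<open>s1\<close> of \<open>s0\<close> under the exchange of \<open>0\<close> and
  \<open>1\<close>, and \<open>s3\<close>, \<open>s4\<close> of \<open>s0\<close>, \<open>s1\<close> under the exchange of the two halves of the system.
\<close>

lemma solution_on_s1:
  assumes "solution_on D ((f0, f1, f2, f3, f4, g1, g2), (\<alpha>0, \<alpha>1, \<alpha>2, \<alpha>3, \<alpha>4))"
    and "normalized (\<alpha>0, \<alpha>1, \<alpha>2, \<alpha>3, \<alpha>4)"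
    and "\<forall>t\<in>D. f1 t \<noteq> 0"
  shows "solution_on D (s1 ((f0, f1, f2, f3, f4, g1, g2), (\<alpha>0, \<alpha>1, \<alpha>2, \<alpha>3, \<alpha>4)))"
  using solution_on_swap_01[OF solution_on_s0[OF solution_on_swap_01[OF assms(1)],
      unfolded s0.simps]] assms(2,3)
  by (simp add: add_ac)

lemma solution_on_s3:
  assumes "solution_on D ((f0, f1, f2, f3, f4, g1, g2), (\<alpha>0, \<alpha>1, \<alpha>2, \<alpha>3, \<alpha>4))"
    and "normalized (\<alpha>0, \<alpha>1, \<alpha>2, \<alpha>3, \<alpha>4)"
    and "\<forall>t\<in>D. f3 t \<noteq> 0"
  shows "solution_on D (s3 ((f0, f1, f2, f3, f4, g1, g2), (\<alpha>0, \<alpha>1, \<alpha>2, \<alpha>3, \<alpha>4)))"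
  using solution_on_swap_01_34[OF solution_on_s0[OF solution_on_swap_01_34[OF assms(1)],
      unfolded s0.simps]] assms(2,3)
  by (simp add: add_ac)

lemma solution_on_s4:
  assumes "solution_on D ((f0, f1, f2, f3, f4, g1, g2), (\<alpha>0, \<alpha>1, \<alpha>2, \<alpha>3, \<alpha>4))"
    and "normalized (\<alpha>0, \<alpha>1, \<alpha>2, \<alpha>3, \<alpha>4)"
    and "\<forall>t\<in>D. f4 t \<noteq> 0"
  shows "solution_on D (s4 ((f0, f1, f2, f3, f4, g1, g2), (\<alpha>0, \<alpha>1, \<alpha>2, \<alpha>3, \<alpha>4)))"
  using solution_on_swap_01_34[OF solution_on_s1[OF solution_on_swap_01_34[OF assms(1)],
      unfolded s1.simps]] assms(2,3)
  by (simp add: add_ac)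

lemma normalized_reflections:
  assumes "normalized \<alpha>"
  shows "normalized (snd (s0 (u, \<alpha>)))" and "normalized (snd (s1 (u, \<alpha>)))"
    and "normalized (snd (s2 (u, \<alpha>)))" and "normalized (snd (s3 (u, \<alpha>)))"
    and "normalized (snd (s4 (u, \<alpha>)))"
  using assms by (cases u, cases \<alpha>, simp add: algebra_simps)+

theorem theorem0p1:
  fixes \<alpha>0 \<alpha>1 \<alpha>2 \<alpha>3 \<alpha>4 :: complex
  assumes "normalized (\<alpha>0, \<alpha>1, \<alpha>2, \<alpha>3, \<alpha>4)"
  shows "invariant_under s0 (\<lambda>(f0, f1, f2, f3, f4, g1, g2). f0) (\<alpha>0, \<alpha>1, \<alpha>2, \<alpha>3, \<alpha>4) \<and>
         invariant_under s1 (\<lambda>(f0, f1, f2, f3, f4, g1, g2). f1) (\<alpha>0, \<alpha>1, \<alpha>2, \<alpha>3, \<alpha>4) \<and>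
         invariant_under s2 (\<lambda>(f0, f1, f2, f3, f4, g1, g2). f2) (\<alpha>0, \<alpha>1, \<alpha>2, \<alpha>3, \<alpha>4) \<and>
         invariant_under s3 (\<lambda>(f0, f1, f2, f3, f4, g1, g2). f3) (\<alpha>0, \<alpha>1, \<alpha>2, \<alpha>3, \<alpha>4) \<and>
         invariant_under s4 (\<lambda>(f0, f1, f2, f3, f4, g1, g2). f4) (\<alpha>0, \<alpha>1, \<alpha>2, \<alpha>3, \<alpha>4)"
  using assms unfolding invariant_under_def
  by (auto simp del: normalized.simps solution_on.simps s0.simps s1.simps s2.simps s3.simps s4.simps
      intro: normalized_reflections
        solution_on_s0 solution_on_s1 solution_on_s2 solution_on_s3 solution_on_s4)

end
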